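(* Let $P\in\mathbb{R}_+^{m\times n}$ be a probability matrix and let $k\le\min\{m,n\}$ be a positive integer. Let $\mathbf{Q}^0\in\boldsymbol{\mathcal{Q}}$ have (strictly) positive elements, and for $t\ge 0$ let $$\mathbf{P}^t=\mathbf{P}^*(\mathbf{Q}^t),\qquad \mathbf{Q}^{t+1}=\mathbf{Q}^*(\mathbf{P}^t).$$ Put $Q^t(ij)=\sum_l\mathbf{Q}^t(ilj)$. Then the update gain at each iteration $t\ge0$ is given by $$D(P||Q^t)-D(P||Q^{t+1})=D(\mathbf{P}^t||\mathbf{P}^{t+1})+D(\mathbf{Q}^{t+1}||\mathbf{Q}^t).$$
   Context: $\mathbb{R}_+=[0,\infty)$. A probability matrix is a matrix $P$ with $P(ij)\ge 0$ and $\sum_{ij}P(ij)=1$. $e$ denotes a column vector of ones of the appropriate size. Given $P$ and $k$, define $$\boldsymbol{\mathcal{P}}=\Big\{\mathbf{P}\in\mathbb{R}_+^{m\times k\times n}:\ \sum_{l}\mathbf{P}(ilj)=P(ij)\ \text{for all } i,j\Big\},$$ $$\boldsymbol{\mathcal{Q}}=\Big\{\mathbf{Q}\in\mathbb{R}_+^{m\times k\times n}:\ \mathbf{Q}(ilj)=Q_-(il)Q_+(lj)\ \text{for some } Q_-\in\mathbb{R}_+^{m\times k},\ Q_+\in\mathbb{R}_+^{k\times n}\ \text{with } Q_+e=e,\ e^\top Q_-e=1\Big\}.$$ For $\mathbf{Q}\in\boldsymbol{\mathcal{Q}}$ with $Q(ij)=\sum_l\mathbf{Q}(ilj)$, the tensor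 $\mathbf{P}^*(\mathbf{Q})$ (minimizer of $D(\mathbf{P}||\mathbf{Q})$ over $\mathbf{P}\in\boldsymbol{\mathcal{P}}$) is defined by $$\mathbf{P}^*(ilj)=\frac{\mathbf{Q}(ilj)}{Q(ij)}P(ij),$$ with $\mathbf{P}^*(ilj)=0$ if $Q(ij)=0$. For $\mathbf{P}\in\boldsymbol{\mathcal{P}}$, the tensor $\mathbf{Q}^*(\mathbf{P})\in\boldsymbol{\mathcal{Q}}$ (minimizer of $D(\mathbf{P}||\mathbf{Q})$ over $\mathbf{Q}\in\boldsymbol{\mathcal{Q}}$) is $\mathbf{Q}^*(ilj)=Q_-^*(il)Q_+^*(lj)$ with $$Q_-^*(il)=\sum_j\mathbf{P}(ilj),\qquad Q_+^*(lj)=\frac{\sum_i\mathbf{P}(ilj)}{\sum_{ij}\mathbf{P}(ilj)},$$ where, for those $l$ with $\sum_{ij}\mathbf{P}(ilj)=0$, the $Q_+^*(lj)$ are given arbitrary nonnegative values with $\sum_jQ_+^*(lj)=1$. For nonnegative numbers $p,q$ the I-divergence is $D(p||q)=p\log\frac{p}{q}-p+q\in[0,\infty]$, with the conventions $0/0=0$, $0\log0=0$, $p/0=\infty$ for $p>0$; for nonnegative matrices or tensors of the same size, $D$ is the sum of the I-divergences of the corresponding entries. *)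

theory Defs
  imports "HOL-Analysis.Analysis"
begin

text \<open>An \<open>m \<times> n\<close> matrix \<open>A\<close> has entries \<open>A $ i $ j\<close>; an \<open>m \<times> k \<times> n\<close> tensor \<open>T\<close> has entries
  \<open>T $ i $ l $ j\<close> (standing for \<open>T(ilj)\<close>).\<close>

type_synonym ('m, 'n) rmatrix = "((real, 'n) vec, 'm) vec"
type_synonym ('m, 'k, 'n) tensor = "(((real, 'n) vec, 'k) vec, 'm) vec"

definition probability_matrix :: "('m::finite, 'n::finite) rmatrix \<Rightarrow> bool" where
  "probability_matrix P \<longleftrightarrow>
     (\<forall>i j. 0 \<le> P $ i $ j) \<and> (\<Sum>i\<in>UNIV. \<Sum>j\<in>UNIV. P $ i $ j) = 1"

text \<open>The I-divergence of \<open>p, q \<ge> 0\<close>. The first two cases are the conventions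
  \<open>0 log 0 = 0 log (0/0) = 0\<close> and \<open>p/0 = \<infinity>\<close> for \<open>p > 0\<close>.
  The codomain is \<^typ>\<open>ereal\<close> rather than \<^typ>\<open>ennreal\<close>, because subtraction on the latter is
  truncated.\<close>

definition idiv :: "real \<Rightarrow> real \<Rightarrow> ereal" where
  "idiv p q =
     (if p = 0 then ereal q
      else if q = 0 then \<infinity>
      else ereal (p * ln (p / q) - p + q))"

definition idiv_matrix ::
    "('m::finite, 'n::finite) rmatrix \<Rightarrow> ('m, 'n) rmatrix \<Rightarrow> ereal" where
  "idiv_matrix A B = (\<Sum>i\<in>UNIV. \<Sum>j\<in>UNIV. idiv (A $ i $ j) (B $ i $ j))"

definition idiv_tensor ::
    "('m::finite, 'k::finite, 'n::finite) tensor \<Rightarrow> ('m, 'k, 'n) tensor \<Rightarrow> ereal" where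
  "idiv_tensor S T =
     (\<Sum>i\<in>UNIV. \<Sum>l\<in>UNIV. \<Sum>j\<in>UNIV. idiv (S $ i $ l $ j) (T $ i $ l $ j))"

definition marginal ::
    "('m::finite, 'k::finite, 'n::finite) tensor \<Rightarrow> ('m, 'n) rmatrix" where
  "marginal T = (\<chi> i j. \<Sum>l\<in>UNIV. T $ i $ l $ j)"

definition tensor_of ::
    "('m::finite, 'k::finite) rmatrix \<Rightarrow> ('k, 'n::finite) rmatrix \<Rightarrow> ('m, 'k, 'n) tensor" where
  "tensor_of Qm Qp = (\<chi> i l j. Qm $ i $ l * Qp $ l $ j)"

definition factorized_tensors :: "('m::finite, 'k::finite, 'n::finite) tensor set" where
  "factorized_tensors =
     {tensor_of Qm Qp | Qm Qp.
        (\<forall>i l. 0 \<le> Qm $ i $ l) \<and> (\<forall>l j. 0 \<le> Qp $ l $ j) \<and>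
        (\<forall>l. (\<Sum>j\<in>UNIV. Qp $ l $ j) = 1) \<and>
        (\<Sum>i\<in>UNIV. \<Sum>l\<in>UNIV. Qm $ i $ l) = 1}"

definition P_star ::
    "('m::finite, 'n::finite) rmatrix \<Rightarrow> ('m, 'k::finite, 'n) tensor \<Rightarrow> ('m, 'k, 'n) tensor" where
  "P_star P Q =
     (\<chi> i l j. if marginal Q $ i $ j = 0 then 0
               else Q $ i $ l $ j / marginal Q $ i $ j * P $ i $ j)"

text \<open>\<open>Q\<^sup>*(T)\<close> is unique only up to the choice of those rows \<open>l\<close> of the right factor for which
  \<open>T\<close> has no mass; \<open>is_Q_star T Q\<close> says that \<open>Q\<close> arises from some admissible choice.\<close>

definition is_Q_star ::
    "('m::finite, 'k::finite, 'n::finite) tensor \<Rightarrow> ('m, 'k, 'n) tensor \<Rightarrow> bool" where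
  "is_Q_star T Q \<longleftrightarrow>
     (\<exists>Qm Qp. Q = tensor_of Qm Qp \<and>
        (\<forall>i l. Qm $ i $ l = (\<Sum>j\<in>UNIV. T $ i $ l $ j)) \<and>
        (\<forall>l. let s = (\<Sum>i\<in>UNIV. \<Sum>j\<in>UNIV. T $ i $ l $ j) in
           if s = 0
           then (\<forall>j. 0 \<le> Qp $ l $ j) \<and> (\<Sum>j\<in>UNIV. Qp $ l $ j) = 1
           else (\<forall>j. Qp $ l $ j = (\<Sum>i\<in>UNIV. T $ i $ l $ j) / s)))"

end

(* Let Q be the current tensor, T = P*(Q), Q' = Q*(T) and T' = P*(Q'). Wherever T is positive,
   T / T' = (Q / Q') (Q'(ij) / Q(ij)), and all tensors involved have total mass 1; hence the claim
   reduces to sum T log (Q' / Q) = sum Q' log (Q' / Q). This holds because log (Q' / Q) splits into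
   a function of (i,l) plus a function of (l,j), and T and Q' have the same (i,l)- and
   (l,j)-marginals. All divergences are finite because Q stays positive on the support of P, and
   the zeros of Q are inherited by Q'. *)

theory Submission
  imports Defs
begin

section \<open>Finite divergences as real sums\<close>

lemma idiv_eq_ereal:
  assumes "q = 0 \<Longrightarrow> p = 0"
  shows "idiv p q = ereal (p * ln (p / q) - p + q)"
  using assms by (auto simp: idiv_def)

text \<open>Every entry is finite because zeros of \<open>B\<close> are zeros of \<open>A\<close>,
  and equal total masses cancel the linear terms \<open>- p + q\<close>. Only the logarithmic part
  remains.\<close>

lemma idiv_matrix_eq_ereal:
  fixes A B :: "('m::finite, 'n::finite) rmatrix"
  assumes "\<And>i j. B $ i $ j = 0 \<Longrightarrow> A $ i $ j = 0"
    and "(\<Sum>i\<in>UNIV. \<Sum>j\<in>UNIV. A $ i $ j) = (\<Sum>i\<in>UNIV. \<Sum>j\<in>UNIV. B $ i $ j)"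
  shows "idiv_matrix A B =
    ereal (\<Sum>i\<in>UNIV. \<Sum>j\<in>UNIV. A $ i $ j * ln (A $ i $ j / B $ i $ j))"
  using assms by (simp add: idiv_matrix_def idiv_eq_ereal sum.distrib sum_subtractf)

lemma idiv_tensor_eq_ereal:
  fixes A B :: "('m::finite, 'k::finite, 'n::finite) tensor"
  assumes "\<And>i l j. B $ i $ l $ j = 0 \<Longrightarrow> A $ i $ l $ j = 0"
    and "(\<Sum>i\<in>UNIV. \<Sum>l\<in>UNIV. \<Sum>j\<in>UNIV. A $ i $ l $ j) =
         (\<Sum>i\<in>UNIV. \<Sum>l\<in>UNIV. \<Sum>j\<in>UNIV. B $ i $ l $ j)"
  shows "idiv_tensor A B =
    ereal (\<Sum>i\<in>UNIV. \<Sum>l\<in>UNIV. \<Sum>j\<in>UNIV. A $ i $ l $ j * ln (A $ i $ l $ j / B $ i $ l $ j))"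
  using assms by (simp add: idiv_tensor_def idiv_eq_ereal sum.distrib sum_subtractf)

section \<open>Marginals and factorized tensors\<close>

text \<open>Used with a tensor whose marginal is \<open>P\<close>, this lifts a sum weighted by
  \<open>P\<close> to the index set of the tensors, where all the divergences can be
  compared.\<close>

lemma sum_tensor_weighted_marginal:
  fixes T :: "('m::finite, 'k::finite, 'n::finite) tensor"
  shows "(\<Sum>i\<in>UNIV. \<Sum>j\<in>UNIV. marginal T $ i $ j * f i j) =
    (\<Sum>i\<in>UNIV. \<Sum>l\<in>UNIV. \<Sum>j\<in>UNIV. T $ i $ l $ j * f i j)"
  by (subst sum.swap[of _ UNIV UNIV]) (simp add: marginal_def sum_distrib_right)

lemma sum_marginal:
  fixes T :: "('m::finite, 'k::finite, 'n::finite) tensor"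
  shows "(\<Sum>i\<in>UNIV. \<Sum>j\<in>UNIV. marginal T $ i $ j) =
    (\<Sum>i\<in>UNIV. \<Sum>l\<in>UNIV. \<Sum>j\<in>UNIV. T $ i $ l $ j)"
  using sum_tensor_weighted_marginal[of T "\<lambda>_ _. 1"] by simp

lemma factorized_tensorsE:
  assumes "Q \<in> factorized_tensors"
  obtains Qm Qp where "Q = tensor_of Qm Qp"
    and "\<And>i l. 0 \<le> Qm $ i $ l" "\<And>l j. 0 \<le> Qp $ l $ j"
    and "\<And>l. (\<Sum>j\<in>UNIV. Qp $ l $ j) = 1"
    and "(\<Sum>i\<in>UNIV. \<Sum>l\<in>UNIV. Qm $ i $ l) = 1"
  using assms unfolding factorized_tensors_def by blast

lemma factorized_tensors_nonneg:
  "Q \<in> factorized_tensors \<Longrightarrow> 0 \<le> Q $ i $ l $ j"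
  by (elim factorized_tensorsE) (simp add: tensor_of_def)

lemma factorized_tensors_sum:
  "Q \<in> factorized_tensors \<Longrightarrow> (\<Sum>i\<in>UNIV. \<Sum>l\<in>UNIV. \<Sum>j\<in>UNIV. Q $ i $ l $ j) = 1"
  by (elim factorized_tensorsE) (simp add: tensor_of_def flip: sum_distrib_left)

section \<open>The invariant of the iteration and the map \<open>P_star\<close>\<close>

text \<open>Strict positivity of the initial tensor can be lost in one step: a zero row or column of
  \<open>P\<close> makes entries of the next tensor vanish. Positivity where \<open>P\<close> is
  nonzero survives every step.\<close>

definition positive_on_support ::
    "('m::finite, 'n::finite) rmatrix \<Rightarrow> ('m, 'k::finite, 'n) tensor \<Rightarrow> bool" where
  "positive_on_support P Q \<longleftrightarrow>
     Q \<in> factorized_tensors \<and> (\<forall>i l j. P $ i $ j \<noteq> 0 \<longrightarrow> 0 < Q $ i $ l $ j)"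

lemma positive_on_supportD:
  assumes "positive_on_support P Q"
  shows "Q \<in> factorized_tensors" "P $ i $ j \<noteq> 0 \<Longrightarrow> 0 < Q $ i $ l $ j"
  using assms by (auto simp: positive_on_support_def)

lemma marginal_pos:
  assumes "positive_on_support P Q" "P $ i $ j \<noteq> 0"
  shows "0 < marginal Q $ i $ j"
  using positive_on_supportD(2)[OF assms] by (auto simp: marginal_def intro!: sum_pos)

lemma P_star_nonneg:
  assumes "probability_matrix P" "positive_on_support P Q"
  shows "0 \<le> P_star P Q $ i $ l $ j"
  using assms factorized_tensors_nonneg[OF positive_on_supportD(1)[OF assms(2)]]
  by (auto simp: P_star_def probability_matrix_def marginal_def
        intro!: mult_nonneg_nonneg divide_nonneg_nonneg sum_nonneg)

text \<open>A vanishing marginal of \<open>Q\<close> forces \<open>P $ i $ j = 0\<close>, and then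
  both sides are 0, so the case distinction in \<open>P_star\<close> disappears.\<close>

lemma P_star_eq:
  assumes "positive_on_support P Q"
  shows "P_star P Q $ i $ l $ j = Q $ i $ l $ j / marginal Q $ i $ j * P $ i $ j"
  using marginal_pos[OF assms, of i j] by (auto simp: P_star_def)

text \<open>The support depends on \<open>P\<close> alone, so consecutive tensors
  \<open>P_star P Q\<close> and \<open>P_star P Q'\<close> vanish at the same places and their
  divergence is finite.\<close>

lemma P_star_eq_0_iff:
  assumes "positive_on_support P Q"
  shows "P_star P Q $ i $ l $ j = 0 \<longleftrightarrow> P $ i $ j = 0"
  using marginal_pos[OF assms, of i j] positive_on_supportD(2)[OF assms, of i j l]
  by (cases "P $ i $ j = 0") (auto simp: P_star_eq[OF assms])

lemma marginal_P_star:
  assumes "positive_on_support P Q"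
  shows "marginal (P_star P Q) = P"
proof -
  have "marginal (P_star P Q) $ i $ j = P $ i $ j" for i j
  proof -
    have "marginal (P_star P Q) $ i $ j = marginal Q $ i $ j / marginal Q $ i $ j * P $ i $ j"
      by (simp add: marginal_def[of "P_star P Q"] P_star_eq[OF assms]
            flip: sum_divide_distrib sum_distrib_right) (simp add: marginal_def)
    then show ?thesis
      using marginal_pos[OF assms, of i j] by (cases "P $ i $ j = 0") auto
  qed
  then show ?thesis by (simp add: vec_eq_iff)
qed

section \<open>Properties of \<open>is_Q_star\<close>\<close>

text \<open>The last property is the definition of the right factor with the denominator cleared. In
  this form it also covers a slice \<open>l\<close> without mass: by nonnegativity both sides are
  then 0, whatever row was chosen.\<close>

lemma is_Q_starE:
  fixes T :: "('m::finite, 'k::finite, 'n::finite) tensor"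
  assumes "is_Q_star T Q" and nonneg: "\<And>i l j. 0 \<le> T $ i $ l $ j"
  obtains Qm Qp where "Q = tensor_of Qm Qp"
    and "\<And>i l. Qm $ i $ l = (\<Sum>j\<in>UNIV. T $ i $ l $ j)"
    and "\<And>l j. 0 \<le> Qp $ l $ j"
    and "\<And>l. (\<Sum>j\<in>UNIV. Qp $ l $ j) = 1"
    and "\<And>l j. (\<Sum>i\<in>UNIV. Qm $ i $ l) * Qp $ l $ j = (\<Sum>i\<in>UNIV. T $ i $ l $ j)"
proof -
  define s where "s l = (\<Sum>i\<in>UNIV. \<Sum>j\<in>UNIV. T $ i $ l $ j)" for l
  obtain Qm Qp where Q: "Q = tensor_of Qm Qp"
    and Qm: "\<And>i l. Qm $ i $ l = (\<Sum>j\<in>UNIV. T $ i $ l $ j)"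
    and Qp: "\<And>l. if s l = 0 then (\<forall>j. 0 \<le> Qp $ l $ j) \<and> (\<Sum>j\<in>UNIV. Qp $ l $ j) = 1
                  else (\<forall>j. Qp $ l $ j = (\<Sum>i\<in>UNIV. T $ i $ l $ j) / s l)"
    using assms(1) unfolding is_Q_star_def Let_def s_def by blast
  have s_swap: "s l = (\<Sum>j\<in>UNIV. \<Sum>i\<in>UNIV. T $ i $ l $ j)" for l
    unfolding s_def by (rule sum.swap)
  have s_nonneg: "0 \<le> s l" for l
    by (simp add: s_def sum_nonneg nonneg)
  have "0 \<le> Qp $ l $ j" for l j
    using Qp[of l] s_nonneg[of l] by (auto split: if_splits simp: sum_nonneg nonneg)
  moreover have "(\<Sum>j\<in>UNIV. Qp $ l $ j) = 1" for l
    using Qp[of l] by (auto split: if_splits simp: s_swap simp flip: sum_divide_distrib)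
  moreover have "(\<Sum>i\<in>UNIV. Qm $ i $ l) * Qp $ l $ j = (\<Sum>i\<in>UNIV. T $ i $ l $ j)" for l j
  proof (cases "s l = 0")
    case True
    then have "(\<Sum>i\<in>UNIV. T $ i $ l $ j) = 0"
      by (simp add: s_swap sum_nonneg_eq_0_iff sum_nonneg nonneg)
    with True show ?thesis by (simp add: Qm s_def)
  next
    case False
    then show ?thesis using Qp[of l] by (simp add: Qm flip: s_def)
  qed
  ultimately show thesis using that Q Qm by blast
qed

text \<open>Where \<open>P\<close> is nonzero, the entry of \<open>P_star P Q\<close> is positive.
  It contributes to its (i,l)-marginal and to its (l,j)-marginal, so both factors of the new tensor
  are positive there.\<close>

lemma positive_on_support_Q_star:
  fixes Q :: "('m::finite, 'k::finite, 'n::finite) tensor"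
  assumes "probability_matrix P" "positive_on_support P Q" "is_Q_star (P_star P Q) Q'"
  shows "positive_on_support P Q'"
proof -
  let ?T = "P_star P Q"
  note nonneg = P_star_nonneg[OF assms(1,2)]
  obtain Qm Qp where Q': "Q' = tensor_of Qm Qp"
    and Qm: "\<And>i l. Qm $ i $ l = (\<Sum>j\<in>UNIV. ?T $ i $ l $ j)"
    and Qp: "\<And>l j. 0 \<le> Qp $ l $ j" "\<And>l. (\<Sum>j\<in>UNIV. Qp $ l $ j) = 1"
    and marg: "\<And>l j. (\<Sum>i\<in>UNIV. Qm $ i $ l) * Qp $ l $ j = (\<Sum>i\<in>UNIV. ?T $ i $ l $ j)"
    using is_Q_starE[OF assms(3) nonneg] by blast
  have Qm_nonneg: "0 \<le> Qm $ i $ l" for i l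
    by (simp add: Qm sum_nonneg nonneg)
  \<comment> \<open>The mass of \<open>Qm\<close> is that of \<open>?T\<close>, hence that of its
    marginal \<open>P\<close>.\<close>
  have "(\<Sum>i\<in>UNIV. \<Sum>l\<in>UNIV. Qm $ i $ l) = 1"
    using assms(1) sum_marginal[of ?T]
    by (simp add: Qm marginal_P_star[OF assms(2)] probability_matrix_def)
  then have "Q' \<in> factorized_tensors"
    unfolding factorized_tensors_def using Q' Qm_nonneg Qp by blast
  moreover have "0 < Q' $ i $ l $ j" if "P $ i $ j \<noteq> 0" for i l j
  proof -
    have T: "0 < ?T $ i $ l $ j"
      using that P_star_eq_0_iff[OF assms(2)] nonneg[of i l j] by (simp add: order_less_le)
    have "0 < Qm $ i $ l"
      unfolding Qm by (rule sum_pos2[of _ j]) (simp_all add: T nonneg)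
    moreover have "0 < (\<Sum>i\<in>UNIV. ?T $ i $ l $ j)"
      by (rule sum_pos2[of _ i]) (simp_all add: T nonneg)
    then have "Qp $ l $ j \<noteq> 0"
      using marg[of l j] by auto
    ultimately show ?thesis
      using Qp(1)[of l j] by (simp add: Q' tensor_of_def order_less_le)
  qed
  ultimately show ?thesis by (simp add: positive_on_support_def)
qed

text \<open>A zero of \<open>Q\<close> comes from a zero of one of its factors, which annihilates a
  whole line of \<open>P_star P Q\<close>, in direction j or in direction i. The corresponding
  marginal, and with it the new entry, vanishes.\<close>

lemma Q_star_absolutely_continuous:
  fixes Q :: "('m::finite, 'k::finite, 'n::finite) tensor"
  assumes "probability_matrix P" "positive_on_support P Q" "is_Q_star (P_star P Q) Q'"
    and "Q $ i $ l $ j = 0"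
  shows "Q' $ i $ l $ j = 0"
proof -
  let ?T = "P_star P Q"
  note nonneg = P_star_nonneg[OF assms(1,2)]
  obtain Qm Qp where Q': "Q' = tensor_of Qm Qp"
    and Qm: "\<And>i l. Qm $ i $ l = (\<Sum>j\<in>UNIV. ?T $ i $ l $ j)"
    and marg: "\<And>l j. (\<Sum>i\<in>UNIV. Qm $ i $ l) * Qp $ l $ j = (\<Sum>i\<in>UNIV. ?T $ i $ l $ j)"
    using is_Q_starE[OF assms(3) nonneg] by metis
  have Qm_nonneg: "0 \<le> Qm $ i $ l" for i l
    by (simp add: Qm sum_nonneg nonneg)
  obtain Rm Rp where Q: "Q = tensor_of Rm Rp"
    using positive_on_supportD(1)[OF assms(2)] by (elim factorized_tensorsE)
  from assms(4) consider "Rm $ i $ l = 0" | "Rp $ l $ j = 0"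
    by (auto simp: Q tensor_of_def)
  then show ?thesis
  proof cases
    case 1
    then show ?thesis
      by (simp add: Q' tensor_of_def Qm P_star_eq[OF assms(2)]) (simp add: Q tensor_of_def)
  next
    case 2
    then have "(\<Sum>i\<in>UNIV. ?T $ i $ l $ j) = 0"
      by (simp add: P_star_eq[OF assms(2)]) (simp add: Q tensor_of_def)
    \<comment> \<open>The first alternative is a slice \<open>l\<close> without mass. There
      \<open>Qp $ l $ j\<close> may be a nonzero arbitrary choice, but every
      \<open>Qm $ i $ l\<close> is 0.\<close>
    then have "(\<Sum>i\<in>UNIV. Qm $ i $ l) = 0 \<or> Qp $ l $ j = 0"
      using marg[of l j] by simp
    then show ?thesis
      by (auto simp: Q' tensor_of_def sum_nonneg_eq_0_iff Qm_nonneg)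
  qed
qed

text \<open>Such a sum only sees the two marginals of a tensor. Those of \<open>Q\<close> agree with
  those of \<open>T\<close>: over j because the rows of \<open>Qp\<close> sum to 1, over i by the
  cleared-denominator identity \<open>marg\<close>.\<close>

lemma Q_star_sum_separable:
  fixes T :: "('m::finite, 'k::finite, 'n::finite) tensor"
  assumes "is_Q_star T Q" "\<And>i l j. 0 \<le> T $ i $ l $ j"
  shows "(\<Sum>i\<in>UNIV. \<Sum>l\<in>UNIV. \<Sum>j\<in>UNIV. T $ i $ l $ j * (a i l + b l j)) =
    (\<Sum>i\<in>UNIV. \<Sum>l\<in>UNIV. \<Sum>j\<in>UNIV. Q $ i $ l $ j * (a i l + b l j))"
proof -
  obtain Qm Qp where Q: "Q = tensor_of Qm Qp"
    and Qm: "\<And>i l. Qm $ i $ l = (\<Sum>j\<in>UNIV. T $ i $ l $ j)"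
    and Qp: "\<And>l. (\<Sum>j\<in>UNIV. Qp $ l $ j) = 1"
    and marg: "\<And>l j. (\<Sum>i\<in>UNIV. Qm $ i $ l) * Qp $ l $ j = (\<Sum>i\<in>UNIV. T $ i $ l $ j)"
    using is_Q_starE[OF assms] by metis
  have il: "(\<Sum>j\<in>UNIV. Q $ i $ l $ j) = (\<Sum>j\<in>UNIV. T $ i $ l $ j)" for i l
    by (simp add: Q tensor_of_def Qp flip: sum_distrib_left) (simp add: Qm)
  have lj: "(\<Sum>i\<in>UNIV. Q $ i $ l $ j) = (\<Sum>i\<in>UNIV. T $ i $ l $ j)" for l j
    by (simp add: Q tensor_of_def flip: sum_distrib_right marg)
  have split: "(\<Sum>i\<in>UNIV. \<Sum>l\<in>UNIV. \<Sum>j\<in>UNIV. X $ i $ l $ j * (a i l + b l j)) =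
    (\<Sum>i\<in>UNIV. \<Sum>l\<in>UNIV. (\<Sum>j\<in>UNIV. X $ i $ l $ j) * a i l) +
    (\<Sum>l\<in>UNIV. \<Sum>j\<in>UNIV. (\<Sum>i\<in>UNIV. X $ i $ l $ j) * b l j)"
    for X :: "('m, 'k, 'n) tensor"
  proof -
    have "(\<Sum>i\<in>UNIV. \<Sum>l\<in>UNIV. \<Sum>j\<in>UNIV. X $ i $ l $ j * b l j) =
      (\<Sum>l\<in>UNIV. \<Sum>i\<in>UNIV. \<Sum>j\<in>UNIV. X $ i $ l $ j * b l j)"
      by (rule sum.swap)
    also have "\<dots> = (\<Sum>l\<in>UNIV. \<Sum>j\<in>UNIV. \<Sum>i\<in>UNIV. X $ i $ l $ j * b l j)"
      by (intro sum.cong refl sum.swap)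
    finally show ?thesis
      by (simp add: distrib_left sum.distrib sum_distrib_right)
  qed
  show ?thesis
    unfolding split il lj ..
qed

section \<open>The gain of a single step\<close>

lemma update_gain:
  fixes Q :: "('m::finite, 'k::finite, 'n::finite) tensor"
  assumes P: "probability_matrix P" and Q: "positive_on_support P Q"
    and Q_star: "is_Q_star (P_star P Q) Q'"
  shows "idiv_matrix P (marginal Q) < \<infinity>"
    and "idiv_matrix P (marginal Q') < \<infinity>"
    and "idiv_matrix P (marginal Q) - idiv_matrix P (marginal Q') =
      idiv_tensor (P_star P Q) (P_star P Q') + idiv_tensor Q' Q"
proof -
  let ?T = "P_star P Q" and ?T' = "P_star P Q'"
  note Q' = positive_on_support_Q_star[OF P Q Q_star]
  note fact = positive_on_supportD(1)[OF Q] positive_on_supportD(1)[OF Q']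
  \<comment> \<open>The weights are \<open>?T\<close> for \<open>R = Q\<close> and for
    \<open>R = Q'\<close> alike, since \<open>?T\<close> has marginal \<open>P\<close>. Both
    divergences thus become sums that can be subtracted termwise.\<close>
  have matrix: "idiv_matrix P (marginal R) = ereal (\<Sum>i\<in>UNIV. \<Sum>l\<in>UNIV. \<Sum>j\<in>UNIV.
      ?T $ i $ l $ j * ln (P $ i $ j / marginal R $ i $ j))"
    if R: "positive_on_support P R" for R :: "('m, 'k, 'n) tensor"
  proof -
    have "idiv_matrix P (marginal R) =
      ereal (\<Sum>i\<in>UNIV. \<Sum>j\<in>UNIV. P $ i $ j * ln (P $ i $ j / marginal R $ i $ j))"
    proof (rule idiv_matrix_eq_ereal)
      show "P $ i $ j = 0" if "marginal R $ i $ j = 0" for i j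
        using marginal_pos[OF R, of i j] that by auto
      show "(\<Sum>i\<in>UNIV. \<Sum>j\<in>UNIV. P $ i $ j) = (\<Sum>i\<in>UNIV. \<Sum>j\<in>UNIV. marginal R $ i $ j)"
        using P factorized_tensors_sum[OF positive_on_supportD(1)[OF R]]
        by (simp add: sum_marginal probability_matrix_def)
    qed
    then show ?thesis
      using sum_tensor_weighted_marginal[of ?T "\<lambda>i j. ln (P $ i $ j / marginal R $ i $ j)"]
      by (simp add: marginal_P_star[OF Q])
  qed
  then show "idiv_matrix P (marginal Q) < \<infinity>" "idiv_matrix P (marginal Q') < \<infinity>"
    using Q Q' by simp_all
  have T_T': "idiv_tensor ?T ?T' = ereal (\<Sum>i\<in>UNIV. \<Sum>l\<in>UNIV. \<Sum>j\<in>UNIV.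
      ?T $ i $ l $ j * ln (?T $ i $ l $ j / ?T' $ i $ l $ j))"
    using sum_marginal[of ?T] sum_marginal[of ?T']
    by (intro idiv_tensor_eq_ereal)
      (simp_all add: P_star_eq_0_iff[OF Q] P_star_eq_0_iff[OF Q']
        marginal_P_star[OF Q] marginal_P_star[OF Q'])
  have Q'_Q: "idiv_tensor Q' Q = ereal (\<Sum>i\<in>UNIV. \<Sum>l\<in>UNIV. \<Sum>j\<in>UNIV.
      Q' $ i $ l $ j * ln (Q' $ i $ l $ j / Q $ i $ l $ j))"
    by (intro idiv_tensor_eq_ereal)
      (simp_all add: factorized_tensors_sum fact Q_star_absolutely_continuous[OF P Q Q_star])
  obtain Qm Qp where Qf: "Q = tensor_of Qm Qp"
    and Qm: "\<And>i l. 0 \<le> Qm $ i $ l" and Qp: "\<And>l j. 0 \<le> Qp $ l $ j"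
    using factorized_tensorsE[OF fact(1)] by blast
  obtain Rm Rp where Q'f: "Q' = tensor_of Rm Rp"
    and Rm: "\<And>i l. 0 \<le> Rm $ i $ l" and Rp: "\<And>l j. 0 \<le> Rp $ l $ j"
    using factorized_tensorsE[OF fact(2)] by blast
  define a where "a i l = ln (Rm $ i $ l / Qm $ i $ l)" for i l
  define b where "b l j = ln (Rp $ l $ j / Qp $ l $ j)" for l j
  \<comment> \<open>At a zero of \<open>Q'\<close> this may fail, as \<open>ln 0 = 0\<close> for one
    factor leaves the logarithm of the other. Such entries carry weight 0 in the sums below.\<close>
  have ln_split: "ln (Q' $ i $ l $ j / Q $ i $ l $ j) = a i l + b l j"
    if "Q' $ i $ l $ j \<noteq> 0" for i l j
  proof -
    from that Q_star_absolutely_continuous[OF P Q Q_star] have "Q $ i $ l $ j \<noteq> 0" by blast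
    with that have "0 < Qm $ i $ l" "0 < Qp $ l $ j" "0 < Rm $ i $ l" "0 < Rp $ l $ j"
      using Qm Qp Rm Rp by (auto simp: Qf Q'f tensor_of_def order_less_le)
    then show ?thesis
      by (simp add: Qf Q'f tensor_of_def a_def b_def ln_div ln_mult)
  qed
  \<comment> \<open>Where \<open>P\<close> is nonzero, the factors \<open>P $ i $ j\<close> and both
    marginals cancel between the three logarithms, leaving \<open>Q' / Q\<close>; elsewhere the
    weight \<open>?T\<close> is 0.\<close>
  have T_split: "?T $ i $ l $ j * ln (P $ i $ j / marginal Q $ i $ j)
      - ?T $ i $ l $ j * ln (P $ i $ j / marginal Q' $ i $ j)
      - ?T $ i $ l $ j * ln (?T $ i $ l $ j / ?T' $ i $ l $ j)
      = ?T $ i $ l $ j * (a i l + b l j)" for i l j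
  proof (cases "P $ i $ j = 0")
    case True
    then show ?thesis by (simp add: P_star_eq[OF Q])
  next
    case False
    then have "0 < P $ i $ j"
      using P by (simp add: probability_matrix_def order_less_le)
    moreover note marginal_pos[OF Q False] marginal_pos[OF Q' False]
      positive_on_supportD(2)[OF Q False, of l] positive_on_supportD(2)[OF Q' False, of l]
    ultimately have "ln (P $ i $ j / marginal Q $ i $ j) - ln (P $ i $ j / marginal Q' $ i $ j)
      - ln (?T $ i $ l $ j / ?T' $ i $ l $ j) = ln (Q' $ i $ l $ j / Q $ i $ l $ j)"
      by (simp add: P_star_eq[OF Q] P_star_eq[OF Q'] ln_div ln_mult)
    also have "\<dots> = a i l + b l j"
      using positive_on_supportD(2)[OF Q' False, of l] by (intro ln_split) simp
    finally show ?thesis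
      by (simp flip: right_diff_distrib)
  qed
  have Q'_split: "Q' $ i $ l $ j * ln (Q' $ i $ l $ j / Q $ i $ l $ j)
      = Q' $ i $ l $ j * (a i l + b l j)" for i l j
    using ln_split by (cases "Q' $ i $ l $ j = 0") simp_all
  show "idiv_matrix P (marginal Q) - idiv_matrix P (marginal Q') =
      idiv_tensor ?T ?T' + idiv_tensor Q' Q"
    \<comment> \<open>The separable sum weighted by \<open>Q'\<close> is exchanged for the one
      weighted by \<open>?T\<close>, which \<open>T_split\<close> expands into the other three
      sums.\<close>
    unfolding matrix[OF Q] matrix[OF Q'] T_T' Q'_Q Q'_split
      Q_star_sum_separable[OF Q_star P_star_nonneg[OF P Q], symmetric] T_split[symmetric]
    by (simp add: sum_subtractf)
qed

theorem proposition4p1: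
  fixes P :: "('m::finite, 'n::finite) rmatrix"
    and Q T :: "nat \<Rightarrow> ('m, 'k::finite, 'n) tensor"
    and t :: nat
  assumes "probability_matrix P"
    and "CARD('k) \<le> min CARD('m) CARD('n)"
    and "Q 0 \<in> factorized_tensors"
    and "\<And>i l j. 0 < Q 0 $ i $ l $ j"
    and "\<And>s. T s = P_star P (Q s)"
    and "\<And>s. is_Q_star (T s) (Q (Suc s))"
  shows "idiv_matrix P (marginal (Q t)) < \<infinity> \<and>
         idiv_matrix P (marginal (Q (Suc t))) < \<infinity> \<and>
         idiv_matrix P (marginal (Q t)) - idiv_matrix P (marginal (Q (Suc t)))
           = idiv_tensor (T t) (T (Suc t)) + idiv_tensor (Q (Suc t)) (Q t)"
proof -
  have Q_star: "is_Q_star (P_star P (Q s)) (Q (Suc s))" for s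
    using assms(5,6) by simp
  \<comment> \<open>Positivity of \<open>Q 0\<close> starts the invariant, which persists for any
    admissible choice of \<open>Q (Suc s)\<close>.\<close>
  have "positive_on_support P (Q s)" for s
  proof (induction s)
    case 0
    show ?case using assms(3,4) by (simp add: positive_on_support_def)
  next
    case (Suc s)
    then show ?case using positive_on_support_Q_star[OF assms(1) _ Q_star] by blast
  qed
  then show ?thesis
    using update_gain[OF assms(1) _ Q_star] by (simp add: assms(5))
qed

end
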